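(* Let $s \ge 1$ be an integer and $V \subseteq \mathbb{N}_+$ a nonempty set. Every instance of $\mathbf{BusOut}(\mathcal{B}(s,1,V))$ (i.e. every eligible configuration with $s$ parking spots, all initially empty, using at most one color and bus capacities in $V$) is solvable.
   Context: Bus Out model. Fix a set of colors. A passenger queue is a finite sequence of colors. A parking spot is either empty, denoted $\varepsilon$, or occupied by a bus, written $(x,k)$ with $x$ a color and $k \ge 1$ the number of remaining seats. A spot occupancy state with $s$ spots is an $s$-tuple of spot states; $\varepsilon^s$ denotes all $s$ spots empty. A congestion graph is a finite directed graph whose vertices (buses) are labeled by a pair (color, capacity) with capacity a positive integer; an edge $u\to v$ means bus $v$ blocks bus $u$. A vertex is free if its out-degree is $0$. A configuration is a triple $(G,Q,S)$ of a congestion graph, a passenger queue and a spot occupancy state; it is empty if $G$ and $Q$ are empty and all spots are $\varepsilon$. $(G,Q,S)$ can transition to $(G',Q',S')$ if either (1) $Q'=Q$, $G'$ is $G$ with a free vertex labeled $(x,k)$ removed, and $S'$ is $S$ with one entry $\varepsilon$ replaced by $(x,k)$; or (2) $G'=G$, $Q'$ is $Q$ with its first element $x$ removed, and $S'$ is $S$ with an entry $(x,k+1)$ replaced by $(x,k)$ for some $k\ge1$, or an entry $(x,1)$ replaced by $\varepsilon$. Whenever a transition of type (2) is applicable, it is performed before any transition of type (1) may be chosen. A configuration is solvable if some sequence of transitions leads to the empty configuration. A configuration is eligible if $G$ is acyclic and, for each color, the total capacity of buses of that color equals the number of passengers of that color. For $s,c\in\mathbb{N}_+$ and nonempty $V\subseteq\mathbb{N}_+$,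 $\mathcal{B}(s,c,V)$ is the class of eligible configurations with exactly $s$ parking spots, at most $c$ distinct colors among buses and passengers, and all bus capacities in $V$. For a class $\mathcal{B}$, $\mathbf{BusOut}(\mathcal{B})$ is the decision problem: given a configuration $(G,Q,\varepsilon^s)$ in $\mathcal{B}$ (initial spots all empty), decide whether it is solvable. *)

theory Defs
  imports "Graph_Theory.Digraph"
begin

text \<open>
  An arc from \<open>u\<close> to \<open>v\<close> of the underlying digraph means that bus \<open>v\<close> blocks bus \<open>u\<close>.  The labels
  are total functions; their values outside the vertex set carry no meaning.
\<close>

record ('v, 'e, 'c) congestion_graph =
  digraph_of :: "('v, 'e) pre_digraph"
  color :: "'v \<Rightarrow> 'c"
  capacity :: "'v \<Rightarrow> nat"

abbreviation buses :: "('v, 'e, 'c) congestion_graph \<Rightarrow> 'v set" where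
  "buses G \<equiv> verts (digraph_of G)"

definition congestion_graph :: "('v, 'e, 'c) congestion_graph \<Rightarrow> bool" where
  "congestion_graph G \<longleftrightarrow>
     fin_digraph (digraph_of G) \<and> nomulti_digraph (digraph_of G) \<and> (\<forall>v \<in> buses G. capacity G v \<ge> 1)"

definition free :: "('v, 'e, 'c) congestion_graph \<Rightarrow> 'v \<Rightarrow> bool" where
  "free G v \<longleftrightarrow> v \<in> buses G \<and> out_degree (digraph_of G) v = 0"

definition remove_bus :: "'v \<Rightarrow> ('v, 'e, 'c) congestion_graph \<Rightarrow> ('v, 'e, 'c) congestion_graph" where
  "remove_bus v G = G\<lparr>digraph_of := pre_digraph.del_vert (digraph_of G) v\<rparr>"

datatype 'c spot = Empty | Bus 'c nat

type_synonym ('v, 'e, 'c) config = "('v, 'e, 'c) congestion_graph \<times> 'c list \<times> 'c spot list"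

fun configuration :: "('v, 'e, 'c) config \<Rightarrow> bool" where
  "configuration (G, Q, S) \<longleftrightarrow> congestion_graph G \<and> (\<forall>x k. Bus x k \<in> set S \<longrightarrow> k \<ge> 1)"

fun empty_config :: "('v, 'e, 'c) config \<Rightarrow> bool" where
  "empty_config (G, Q, S) \<longleftrightarrow> buses G = {} \<and> Q = [] \<and> set S \<subseteq> {Empty}"

inductive park :: "('v, 'e, 'c) config \<Rightarrow> ('v, 'e, 'c) config \<Rightarrow> bool" where
  "\<lbrakk>free G v; i < length S; S ! i = Empty\<rbrakk>
   \<Longrightarrow> park (G, Q, S) (remove_bus v G, Q, S[i := Bus (color G v) (capacity G v)])"

inductive board :: "('v, 'e, 'c) config \<Rightarrow> ('v, 'e, 'c) config \<Rightarrow> bool" where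
  "\<lbrakk>i < length S; S ! i = Bus x (k + 1); k \<ge> 1\<rbrakk> \<Longrightarrow> board (G, x # Q, S) (G, Q, S[i := Bus x k])"
| "\<lbrakk>i < length S; S ! i = Bus x 1\<rbrakk> \<Longrightarrow> board (G, x # Q, S) (G, Q, S[i := Empty])"

definition transition :: "('v, 'e, 'c) config \<Rightarrow> ('v, 'e, 'c) config \<Rightarrow> bool" where
  "transition C C' \<longleftrightarrow> board C C' \<or> ((\<nexists>D. board C D) \<and> park C C')"

definition solvable :: "('v, 'e, 'c) config \<Rightarrow> bool" where
  "solvable C \<longleftrightarrow> (\<exists>C'. transition\<^sup>*\<^sup>* C C' \<and> empty_config C')"

fun seats :: "'c \<Rightarrow> 'c spot \<Rightarrow> nat" where
  "seats x Empty = 0"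
| "seats x (Bus y k) = (if y = x then k else 0)"

text \<open>
  A bus that is already parked contributes its remaining seats to the balance of its color.  This
  contribution vanishes when all spots are empty, as they are in every problem instance below.
\<close>

fun eligible :: "('v, 'e, 'c) config \<Rightarrow> bool" where
  "eligible (G, Q, S) \<longleftrightarrow>
     acyclic (arcs_ends (digraph_of G)) \<and>
     (\<forall>x. (\<Sum>v | v \<in> buses G \<and> color G v = x. capacity G v) + (\<Sum>p\<leftarrow>S. seats x p) = count_list Q x)"

fun colors :: "('v, 'e, 'c) config \<Rightarrow> 'c set" where
  "colors (G, Q, S) = color G ` buses G \<union> set Q \<union> {x. \<exists>k. Bus x k \<in> set S}"

definition bus_class :: "nat \<Rightarrow> nat \<Rightarrow> nat set \<Rightarrow> ('v, 'e, 'c) config set" where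
  "bus_class s c V =
     {(G, Q, S). configuration (G, Q, S) \<and> eligible (G, Q, S) \<and> length S = s \<and>
        card (colors (G, Q, S)) \<le> c \<and> capacity G ` buses G \<subseteq> V}"

definition bus_out_instances :: "('v, 'e, 'c) config set \<Rightarrow> ('v, 'e, 'c) config set" where
  "bus_out_instances B = {(G, Q, S) \<in> B. \<exists>s. S = replicate s Empty}"

end

theory Submission
  imports Defs
begin

text \<open>
  With a single color every parked bus can be boarded by whoever comes next.  So park any free bus,
  which exists by acyclicity, and let it fill up: the balance of seats and passengers guarantees that
  it departs, leaving an eligible configuration with one bus fewer and all spots empty again.
\<close>

text \<open>A finite acyclic relation has a well-founded converse, and a bus minimal for that
  converse blocks the way of no argument: an arc leaving it would lead to a smaller bus.\<close>

lemma exists_free_bus: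
  assumes "fin_digraph (digraph_of G)" and "acyclic (arcs_ends (digraph_of G))" and "buses G \<noteq> {}"
  obtains v where "free G v"
proof -
  interpret fin_digraph "digraph_of G" by fact
  have "finite (arcs_ends (digraph_of G))"
    by (simp add: arcs_ends_def)
  then have "wf ((arcs_ends (digraph_of G))\<inverse>)"
    using assms(2) by (rule finite_acyclic_wf_converse)
  then obtain v where v: "v \<in> buses G"
    and min: "\<And>w. (w, v) \<in> (arcs_ends (digraph_of G))\<inverse> \<Longrightarrow> w \<notin> buses G"
    using assms(3) by (metis wfE_min')
  have "out_arcs (digraph_of G) v = {}"
  proof (rule ccontr)
    assume "out_arcs (digraph_of G) v \<noteq> {}"
    then obtain e where "e \<in> arcs (digraph_of G)" "tail (digraph_of G) e = v"
      by (auto simp: out_arcs_def)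
    then show False
      using min[of "head (digraph_of G) e"] by (force simp: arcs_ends_def arc_to_ends_def)
  qed
  with v have "free G v"
    by (simp add: free_def out_degree_def)
  then show thesis ..
qed

text \<open>Boarding has priority over parking, so every \<open>board\<close> step is a transition,
  whatever the other spots hold.\<close>

lemma boarding_fills_bus:
  assumes "i < length S" and "S ! i = Bus x k" and "k \<ge> 1"
  shows "transition\<^sup>*\<^sup>* (G, replicate k x @ Q, S) (G, Q, S[i := Empty])"
  using assms
proof (induction k arbitrary: S)
  case (Suc k)
  show ?case
  \<comment> \<open>The last seat is a case of its own: it vacates the spot instead of leaving a bus
    with 0 seats.\<close>
  proof (cases "k = 0")
    case True
    with Suc.prems have "board (G, x # Q, S) (G, Q, S[i := Empty])"
      by (intro board.intros) auto
    with True show ?thesis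
      by (auto simp: transition_def)
  next
    case False
    with Suc.prems have "board (G, x # (replicate k x @ Q), S) (G, replicate k x @ Q, S[i := Bus x k])"
      by (intro board.intros) auto
    then have "transition (G, replicate (Suc k) x @ Q, S) (G, replicate k x @ Q, S[i := Bus x k])"
      by (simp add: transition_def)
    moreover have "transition\<^sup>*\<^sup>* (G, replicate k x @ Q, S[i := Bus x k]) (G, Q, S[i := Empty])"
      using Suc.IH[of "S[i := Bus x k]"] Suc.prems False by simp
    ultimately show ?thesis
      by (rule converse_rtranclp_into_rtranclp)
  qed
qed simp

text \<open>Writing the queue as a function of \<open>G\<close> builds the balance of seats and
  passengers into the statement, so induction on the number of buses preserves it by itself.\<close>

lemma solvable_monochromatic:
  assumes "fin_digraph (digraph_of G)" and "acyclic (arcs_ends (digraph_of G))"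
    and "\<And>v. v \<in> buses G \<Longrightarrow> color G v = x \<and> capacity G v \<ge> 1"
    and "S \<noteq> []" and "set S \<subseteq> {Empty}"
  shows "solvable (G, replicate (\<Sum>v\<in>buses G. capacity G v) x, S)"
  using assms
proof (induction "card (buses G)" arbitrary: G)
  case 0
  then have "buses G = {}"
    by (simp add: fin_digraph.finite_verts)
  with 0 have "empty_config (G, replicate (\<Sum>v\<in>buses G. capacity G v) x, S)"
    by simp
  then show ?case
    unfolding solvable_def by blast
next
  case (Suc n)
  interpret fin_digraph "digraph_of G" by fact
  have "buses G \<noteq> {}"
    using Suc.hyps(2) by auto
  then obtain v where free: "free G v"
    using exists_free_bus Suc.prems(1,2) by blast
  then have v: "v \<in> buses G"
    by (simp add: free_def)
  define G' where "G' = remove_bus v G"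
  have G'_simps: "digraph_of G' = del_vert v" "verts (del_vert v) = buses G - {v}"
    "color G' = color G" "capacity G' = capacity G"
    by (simp_all add: G'_def remove_bus_def verts_del_vert)
  define k R where "k = capacity G v" and "R = replicate (\<Sum>v\<in>buses G'. capacity G' v) x"
  have k: "k \<ge> 1" "color G v = x"
    using Suc.prems(3) v by (auto simp: k_def)
  \<comment> \<open>The first \<open>k\<close> passengers will fill \<open>v\<close>; the rest form
    exactly the queue that the induction hypothesis requires for \<open>G'\<close>.\<close>
  have Q: "replicate (\<Sum>v\<in>buses G. capacity G v) x = replicate k x @ R"
    using v by (simp add: G'_simps k_def R_def replicate_add[symmetric] sum.remove)
  have spot: "0 < length S" "S ! 0 = Empty"
    using Suc.prems(4,5) by (cases S; auto)+
  have "arcs_ends (del_vert v) \<subseteq> arcs_ends (digraph_of G)"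
    by (auto simp: arcs_ends_def arc_to_ends_def arcs_del_vert tail_del_vert head_del_vert)
  then have "acyclic (arcs_ends (digraph_of G'))"
    using Suc.prems(2) acyclic_subset G'_simps(1) by metis
  moreover have "n = card (buses G')"
    using Suc.hyps(2) v by (simp add: G'_simps)
  moreover have "fin_digraph (digraph_of G')"
    using fin_digraph_del_vert by (simp add: G'_simps)
  ultimately have "solvable (G', R, S)"
    unfolding R_def using Suc.hyps(1)[of G'] Suc.prems(3-5) by (simp add: G'_simps)
  moreover have "transition (G, replicate k x @ R, S) (G', replicate k x @ R, S[0 := Bus x k])"
  proof -
    \<comment> \<open>Parking is allowed only when nobody can board, which holds because all spots
      are empty.\<close>
    have "\<nexists>D. board (G, replicate k x @ R, S) D"
      using Suc.prems(5) by (auto elim!: board.cases dest!: nth_mem)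
    then show ?thesis
      using park.intros[OF free spot, of "replicate k x @ R"] k
      by (simp add: transition_def G'_def k_def)
  qed
  moreover have "transition\<^sup>*\<^sup>* (G', replicate k x @ R, S[0 := Bus x k]) (G', R, S)"
    \<comment> \<open>Spot 0 was \<open>Empty\<close> before \<open>v\<close> parked, so emptying it
      again restores \<open>S\<close>.\<close>
    using boarding_fills_bus[of 0 "S[0 := Bus x k]" x k G' R] spot k list_update_id[of S 0] by simp
  ultimately show ?case
    unfolding Q solvable_def by (meson converse_rtranclp_into_rtranclp rtranclp_trans)
qed

theorem theorem1:
  fixes s :: nat and V :: "nat set" and C :: "('v, 'e, 'c) config"
  assumes "s \<ge> 1" and "V \<noteq> {}" and "V \<subseteq> {1..}"
    and "C \<in> bus_out_instances (bus_class s 1 V)"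
  shows "solvable C"
proof -
  obtain G Q S where C: "C = (G, Q, S)"
    by (cases C)
  have G: "fin_digraph (digraph_of G)" "acyclic (arcs_ends (digraph_of G))"
      "\<And>v. v \<in> buses G \<Longrightarrow> capacity G v \<ge> 1"
    and S: "S = replicate s Empty"
    and card: "card (colors (G, Q, S)) \<le> 1"
    and balance: "\<And>x. (\<Sum>v | v \<in> buses G \<and> color G v = x. capacity G v) + (\<Sum>p\<leftarrow>S. seats x p) = count_list Q x"
    using assms(4)
    by (auto simp: C bus_out_instances_def bus_class_def congestion_graph_def simp del: colors.simps)
  have colors: "colors (G, Q, S) = color G ` buses G \<union> set Q"
    by (auto simp: S)
  \<comment> \<open>Without finiteness the bound on \<open>card\<close> would say nothing, since
    infinite sets have \<open>card\<close> 0.\<close>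
  then have "finite (colors (G, Q, S))"
    using G(1) by (simp add: fin_digraph.finite_verts)
  \<comment> \<open>Inclusion rather than equality also covers the instance without buses and
    passengers, where \<open>x\<close> is arbitrary.\<close>
  with card have "\<exists>x. colors (G, Q, S) \<subseteq> {x}"
    unfolding One_nat_def card_le_Suc0_iff_eq[OF \<open>finite (colors (G, Q, S))\<close>] by blast
  then obtain x where x: "color G ` buses G \<subseteq> {x}" "set Q \<subseteq> {x}"
    using colors by auto
  \<comment> \<open>In the balance for \<open>x\<close>, the parked seats vanish, the buses of color
    \<open>x\<close> are all buses, and the count is the length of the whole queue.\<close>
  have "(\<Sum>p\<leftarrow>S. seats x p) = 0"
    by (simp add: S)
  moreover have "{v. v \<in> buses G \<and> color G v = x} = buses G"
    using x(1) by auto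
  moreover have "Q = replicate (count_list Q x) x"
    using x(2) by (induction Q) auto
  ultimately have "Q = replicate (\<Sum>v\<in>buses G. capacity G v) x"
    using balance[of x] by (metis add.right_neutral)
  then show ?thesis
    using solvable_monochromatic[of G x S] G x(1) S assms(1) unfolding C by auto
qed

end
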